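(* Let $n\ge 1$, let $f_i:\mathbb{R}\to\mathbb{R}$ be continuous for each $i\in\{1,\dots,n\}$, and let $a_{ij}\ge 0$, $i,j\in\{1,\dots,n\}$, be interconnection weights. For $\gamma>0$ consider the networked system $$\dot x_i = f_i(x_i)-\gamma\sum_{j=1}^n a_{ij}(x_i-x_j),\qquad x_i\in\mathbb{R},\quad i\in\{1,\dots,n\},\qquad (\Sigma_\gamma)$$ with state $x=[x_1\ \cdots\ x_n]^\top\in\mathbb{R}^n$. Assume: (1) the directed graph $\mathcal{G}$ with node set $\{1,\dots,n\}$, having a directed edge from node $j$ to node $i$ if and only if $a_{ij}>0$, is connected and contains a directed spanning tree; (2) for each $i\in\{1,\dots,n\}$, the system $\dot x_i=f_i(x_i)+u_i$ with input $u_i\in\mathbb{R}$ and output $x_i$ is state strictly semi-passive in the sense given in the context. Then the solutions of $(\Sigma_\gamma)$ are globally ultimately bounded, uniformly in $\gamma$: for every $\gamma_o>0$ there exists $r=r(\gamma_o)>0$ such that, for every $r_o>0$, there exists $T=T(r_o,\gamma_o)\ge 0$ such that, for all $\gamma\ge\gamma_o$, every maximal forward solution $t\mapsto x(t)$ of $(\Sigma_\gamma)$ starting at time $0$ with $|x(0)|\le r_o$ is defined for all $t\ge 0$ and satisfies $$|x(t)|\le r\qquad\forall\, t\ge T.$$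
   Context: $|\cdot|$ denotes the Euclidean norm. A directed spanning tree in $\mathcal{G}$ is a directed tree, made of edges of $\mathcal{G}$, with a root node from which every other node is reachable by a directed path. A class $\mathcal{K}_\infty$ function $\alpha:\mathbb{R}_{\ge0}\to\mathbb{R}_{\ge0}$ is a continuous, strictly increasing, unbounded function with $\alpha(0)=0$. State strict semi-passivity of $\dot x_i=f_i(x_i)+u_i$ (map $u_i\mapsto x_i$): there exist a continuously differentiable storage function $V_i:\mathbb{R}\to\mathbb{R}_{\ge0}$, a class $\mathcal{K}_\infty$ function $\underline{\alpha}_i$, a constant $\rho_i>0$, a continuous function $H_i:\mathbb{R}\to\mathbb{R}$, and a continuous function $\psi_i:\mathbb{R}_{\ge0}\to\mathbb{R}_{>0}$ such that, for all $x_i\in\mathbb{R}$ and all $u_i\in\mathbb{R}$, $$\underline{\alpha}_i(|x_i|)\le V_i(x_i),\qquad \dot V_i(x_i):=V_i'(x_i)\,\bigl(f_i(x_i)+u_i\bigr)\le 2u_ix_i-H_i(x_i),$$ and $H_i(x_i)\ge\psi_i(|x_i|)$ for all $|x_i|\ge\rho_i$. The functions $f_i$ are only assumed continuous, so solutions (continuously differentiable functions satisfying the differential equation) need not be unique; the conclusion concerns all solutions. The constants $r$ and $T$ may depend on the fixed data $(f_i)$, $(a_{ij})$ but not on $\gamma\geq\gamma_o$. *)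

theory Defs
  imports
    "HOL-Analysis.Analysis"
    "Graph_Theory.Digraph_Component"
    "Graph_Theory.Arc_Walk"
begin

text \<open>The values of \<open>\<alpha>\<close> on negative arguments are irrelevant. Nonnegativity on \<open>{0..}\<close> follows
  from \<open>\<alpha> 0 = 0\<close> and monotonicity.\<close>

definition class_K_infinity :: "(real \<Rightarrow> real) \<Rightarrow> bool" where
  "class_K_infinity \<alpha> \<longleftrightarrow>
     continuous_on {0..} \<alpha> \<and> strict_mono_on {0..} \<alpha> \<and> \<alpha> 0 = 0 \<and> \<not> bdd_above (\<alpha> ` {0..})"

text \<open>State strict semi-passivity of \<open>x' = f x + u\<close>, with input \<open>u\<close> and output \<open>x\<close>. The
  functions \<open>\<alpha>\<close> and \<open>\<psi>\<close> are only used on \<open>{0..}\<close>.\<close>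

definition state_strictly_semi_passive :: "(real \<Rightarrow> real) \<Rightarrow> bool" where
  "state_strictly_semi_passive f \<longleftrightarrow>
     (\<exists>(V :: real \<Rightarrow> real) (\<alpha> :: real \<Rightarrow> real) (\<rho> :: real) (H :: real \<Rightarrow> real) (\<psi> :: real \<Rightarrow> real).
        V C1_differentiable_on UNIV \<and> (\<forall>x. 0 \<le> V x) \<and>
        class_K_infinity \<alpha> \<and>
        0 < \<rho> \<and>
        continuous_on UNIV H \<and>
        continuous_on {0..} \<psi> \<and> (\<forall>s\<ge>0. 0 < \<psi> s) \<and>
        (\<forall>x u. \<alpha> \<bar>x\<bar> \<le> V x \<and> deriv V x * (f x + u) \<le> 2 * u * x - H x) \<and>
        (\<forall>x. \<rho> \<le> \<bar>x\<bar> \<longrightarrow> \<psi> \<bar>x\<bar> \<le> H x))"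

text \<open>The weight \<open>a i j\<close> is that of the edge from \<open>j\<close> to \<open>i\<close>; the pair \<open>(j, i)\<close> is the arc with
  tail \<open>j\<close> and head \<open>i\<close>.\<close>

definition interconnection_graph :: "('n \<Rightarrow> 'n \<Rightarrow> real) \<Rightarrow> ('n, 'n \<times> 'n) pre_digraph" where
  "interconnection_graph a =
     \<lparr>verts = UNIV, arcs = {(j, i). a i j > 0}, tail = fst, head = snd\<rparr>"

text \<open>The predicate \<^const>\<open>spanning_tree\<close> only excludes directed cycles, so it also accepts acyclic
  digraphs that are not directed trees. Here a directed tree has exactly one directed walk
  from its root \<open>z\<close> to each of its vertices (the empty one, in the case of the root).\<close>

definition directed_tree :: "('a, 'b) pre_digraph \<Rightarrow> 'a \<Rightarrow> bool" where
  "directed_tree T z \<longleftrightarrow>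
     wf_digraph T \<and> z \<in> verts T \<and> (\<forall>v\<in>verts T. \<exists>!p. pre_digraph.awalk T z p v)"

definition has_directed_spanning_tree :: "('a, 'b) pre_digraph \<Rightarrow> bool" where
  "has_directed_spanning_tree G \<longleftrightarrow> (\<exists>T z. spanning T G \<and> directed_tree T z)"

definition network_field ::
  "('n \<Rightarrow> real \<Rightarrow> real) \<Rightarrow> ('n \<Rightarrow> 'n \<Rightarrow> real) \<Rightarrow> real \<Rightarrow> real ^ 'n::finite \<Rightarrow> real ^ 'n" where
  "network_field f a \<gamma> x = (\<chi> i. f i (x $ i) - \<gamma> * (\<Sum>j\<in>UNIV. a i j * (x $ i - x $ j)))"

text \<open>A forward solution of \<open>x' = F x\<close> lives on a nondegenerate interval \<open>J\<close> with left endpoint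
  \<open>0 \<in> J\<close>, bounded or not, closed or open on the right; the derivative is one-sided at
  endpoints belonging to \<open>J\<close>, and the values of \<open>x\<close> outside \<open>J\<close> play no role. The last conjunct
  is continuity of the derivative.\<close>

definition forward_solution ::
  "('v::real_normed_vector \<Rightarrow> 'v) \<Rightarrow> real set \<Rightarrow> (real \<Rightarrow> 'v) \<Rightarrow> bool" where
  "forward_solution F J x \<longleftrightarrow>
     is_interval J \<and> J \<subseteq> {0..} \<and> 0 \<in> J \<and> J \<noteq> {0} \<and>
     (\<forall>t\<in>J. (x has_vector_derivative F (x t)) (at t within J)) \<and>
     continuous_on J (\<lambda>t. F (x t))"

definition maximal_forward_solution ::
  "('v::real_normed_vector \<Rightarrow> 'v) \<Rightarrow> real set \<Rightarrow> (real \<Rightarrow> 'v) \<Rightarrow> bool" where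
  "maximal_forward_solution F J x \<longleftrightarrow>
     forward_solution F J x \<and>
     (\<forall>J' y. forward_solution F J' y \<and> J \<subseteq> J' \<and> (\<forall>t\<in>J. y t = x t) \<longrightarrow> J' = J)"

end

theory Submission
  imports Defs "HOL-Complex_Analysis.Great_Picard"
begin

text \<open>Since the semi-passivity inequality is affine in the input, it forces \<open>V' x = 2 * x\<close>, and
  hence \<open>x * f x < 0\<close> for large \<open>\<bar>x\<bar>\<close>. The coupling term never pushes the component of largest
  absolute value outwards. The maximum norm therefore decreases along solutions at a rate that is
  independent of \<open>\<gamma>\<close> until it drops below a fixed threshold, and then stays there. Solutions are
  bounded, so they extend to all times by Peano's existence theorem, which follows from the
  Arzela-Ascoli theorem applied to Tonelli's delayed approximations.\<close>

section \<open>Peano's theorem and continuation of solutions\<close>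

lemma has_vector_derivative_imp_Lipschitz:
  fixes x :: "real \<Rightarrow> 'v::real_normed_vector"
  assumes "convex S"
    and deriv: "\<And>t. t \<in> S \<Longrightarrow> (x has_vector_derivative x' t) (at t within S)"
    and bound: "\<And>t. t \<in> S \<Longrightarrow> norm (x' t) \<le> M"
    and "s \<in> S" "t \<in> S"
  shows "norm (x s - x t) \<le> M * \<bar>s - t\<bar>"
proof -
  have "onorm (\<lambda>h. h *\<^sub>R x' u) \<le> M" if "u \<in> S" for u
    by (rule onorm_le) (use bound[OF that] in \<open>simp add: mult.commute[of M] mult_left_mono\<close>)
  then have "norm (x s - x t) \<le> M * norm (s - t)"
    using deriv assms unfolding has_vector_derivative_def
    by (intro differentiable_bound[where S=S and f'="\<lambda>u h. h *\<^sub>R x' u"]) auto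
  then show ?thesis
    by simp
qed

lemma integral_equation_imp_derivative:
  fixes x :: "real \<Rightarrow> 'v::euclidean_space"
  assumes g: "continuous_on {a..b} g"
    and x: "\<And>t. t \<in> {a..b} \<Longrightarrow> x t = x\<^sub>0 + integral {a..t} g"
    and t: "t \<in> {a..b}"
  shows "(x has_vector_derivative g t) (at t within {a..b})"
proof -
  have "((\<lambda>t. x\<^sub>0 + integral {a..t} g) has_vector_derivative 0 + g t) (at t within {a..b})"
    using integral_has_vector_derivative[OF g t]
    by (intro has_vector_derivative_add has_vector_derivative_const)
  then show ?thesis
    using x t by (auto intro: has_vector_derivative_transform)
qed

section \<open>Tonelli's delayed equations\<close>

lemma continuous_on_delay:
  fixes x :: "real \<Rightarrow> 'v::real_normed_vector"
  assumes "continuous_on {a..b} x" "continuous_on UNIV G" "0 \<le> h"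
  shows "continuous_on {a..b} (\<lambda>s. G (x (max a (s - h))))"
proof -
  have "continuous_on {a..b} (\<lambda>s. x (max a (s - h)))"
    by (rule continuous_on_compose2[OF assms(1)]) (use assms(3) in \<open>auto intro!: continuous_intros\<close>)
  then show ?thesis
    by (rule continuous_on_compose2[OF assms(2)]) simp
qed

text \<open>The right-hand side at time \<open>t\<close> involves \<open>x\<close> only up to
  \<open>max a (t - h)\<close>. Picard iteration therefore becomes exact on a further piece of
  length \<open>h\<close> with each step and reaches \<open>b\<close> after finitely many
  steps.\<close>

lemma delay_integral_equation_solution:
  fixes G :: "'v::euclidean_space \<Rightarrow> 'v" and a b :: real
  assumes G: "continuous_on UNIV G" and h: "0 < h"
  obtains x where "continuous_on {a..b} x"
    "\<And>t. t \<in> {a..b} \<Longrightarrow> x t = x\<^sub>0 + integral {a..t} (\<lambda>s. G (x (max a (s - h))))"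
proof -
  define \<Phi> where "\<Phi> y t = x\<^sub>0 + integral {a..t} (\<lambda>s. G (y (max a (s - h))))"
    for y :: "real \<Rightarrow> 'v" and t
  define y where "y m = (\<Phi> ^^ m) (\<lambda>_. x\<^sub>0)" for m
  have cont: "continuous_on {a..b} (y m)" for m
  proof (induction m)
    case 0
    then show ?case by (simp add: y_def)
  next
    case (Suc m)
    have "continuous_on {a..b} (\<Phi> (y m))"
      unfolding \<Phi>_def using h continuous_on_delay[OF Suc G, of h]
      by (intro continuous_intros indefinite_integral_continuous_1 integrable_continuous_real) auto
    then show ?case by (simp add: y_def)
  qed
  \<comment> \<open>For \<open>s \<le> a + (m + 1) * h\<close> the delayed time
    \<open>max a (s - h)\<close> is at most \<open>a + m * h\<close>, where two consecutive iterates
    already agree. In the base case only \<open>t = a\<close> occurs, where both values are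
    \<open>x\<^sub>0\<close>.\<close>
  have stable: "y (Suc m) t = y m t" if "a \<le> t" "t \<le> a + m * h" for m t
    using that
  proof (induction m arbitrary: t)
    case 0
    then show ?case by (simp add: y_def \<Phi>_def)
  next
    case (Suc m)
    have "\<Phi> (y (Suc m)) t = \<Phi> (y m) t"
      unfolding \<Phi>_def
      by (intro arg_cong2[of _ _ _ _ "(+)"] refl integral_cong arg_cong[of _ _ G] Suc.IH)
        (use Suc.prems h in \<open>auto simp: algebra_simps\<close>)
    then show ?case by (simp add: y_def)
  qed
  obtain m :: nat where "(b - a) / h \<le> m"
    using real_arch_simple by blast
  then have m: "b \<le> a + m * h"
    using h by (simp add: field_simps)
  show thesis
  proof (rule that)
    show "continuous_on {a..b} (y m)" by (rule cont)
    show "y m t = x\<^sub>0 + integral {a..t} (\<lambda>s. G (y m (max a (s - h))))" if "t \<in> {a..b}" for t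
      using stable[of t m] that m by (simp add: y_def \<Phi>_def)
  qed
qed

section \<open>Existence of solutions for continuous fields\<close>

text \<open>The solutions for delays tending to zero share their initial value and, as
  \<open>G\<close> is bounded, the Lipschitz constant \<open>M\<close>. Arzela-Ascoli yields a
  uniformly convergent subsequence, and dominated convergence carries the integral equation over to
  its limit.\<close>

lemma Peano_bounded:
  fixes G :: "'v::euclidean_space \<Rightarrow> 'v"
  assumes G: "continuous_on UNIV G" and M: "\<And>v. norm (G v) \<le> M" and "a \<le> b"
  obtains x where "x a = x\<^sub>0"
    "\<And>t. t \<in> {a..b} \<Longrightarrow> (x has_vector_derivative G (x t)) (at t within {a..b})"
proof -
  define h :: "nat \<Rightarrow> real" where "h n = inverse (Suc n)" for n
  have h: "0 < h n" for n
    by (simp add: h_def)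
  have "0 \<le> M"
    using M[of 0] norm_ge_zero order_trans by blast
  have "\<forall>n. \<exists>y. continuous_on {a..b} y \<and>
      (\<forall>t\<in>{a..b}. y t = x\<^sub>0 + integral {a..t} (\<lambda>s. G (y (max a (s - h n)))))"
    using delay_integral_equation_solution[OF G h] by metis
  then obtain y where conty: "\<And>n. continuous_on {a..b} (y n)"
    and y: "\<And>n t. t \<in> {a..b} \<Longrightarrow> y n t = x\<^sub>0 + integral {a..t} (\<lambda>s. G (y n (max a (s - h n))))"
    by metis
  have contG: "continuous_on {a..b} (\<lambda>s. G (y n (max a (s - h n))))" for n
    by (rule continuous_on_delay[OF conty G]) (simp add: h less_imp_le)
  have lip: "norm (y n s - y n t) \<le> M * \<bar>s - t\<bar>" if "s \<in> {a..b}" "t \<in> {a..b}" for n s t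
    by (rule has_vector_derivative_imp_Lipschitz[OF _ integral_equation_imp_derivative[OF contG y]])
      (use that M in auto)
  have ya: "y n a = x\<^sub>0" for n
    using y[of a n] \<open>a \<le> b\<close> by simp
  obtain x k where contx: "continuous_on {a..b} x" and k: "strict_mono (k :: nat \<Rightarrow> nat)"
    and unif: "\<And>e. 0 < e \<Longrightarrow> \<exists>N. \<forall>n t. n \<ge> N \<and> t \<in> {a..b} \<longrightarrow> norm (y (k n) t - x t) < e"
  proof (rule Arzela_Ascoli[of "{a..b}" y "norm x\<^sub>0 + M * (b - a)"])
    show "norm (y n t) \<le> norm x\<^sub>0 + M * (b - a)" if t: "t \<in> {a..b}" for n t
    proof -
      have "norm (y n t - y n a) \<le> M * \<bar>t - a\<bar>"
        using t by (intro lip) auto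
      also have "\<dots> \<le> M * (b - a)"
        using t \<open>0 \<le> M\<close> by (intro mult_left_mono) auto
      finally show ?thesis
        using norm_triangle_sub[of "y n t" x\<^sub>0] by (simp add: ya)
    qed
    show "\<exists>d>0. \<forall>n s. s \<in> {a..b} \<and> norm (t - s) < d \<longrightarrow> norm (y n t - y n s) < e"
      if t: "t \<in> {a..b}" and "0 < e" for t e
    \<comment> \<open>Dividing by \<open>M + 1\<close> rather than \<open>M\<close> covers the case
      \<open>M = 0\<close>.\<close>
    proof (intro exI[of _ "e / (M + 1)"] conjI allI impI)
      show "0 < e / (M + 1)"
        using \<open>0 < e\<close> \<open>0 \<le> M\<close> by simp
      fix n s assume s: "s \<in> {a..b} \<and> norm (t - s) < e / (M + 1)"
      have "norm (y n t - y n s) \<le> M * \<bar>t - s\<bar>"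
        using t s by (intro lip) auto
      also have "\<dots> \<le> (M + 1) * \<bar>t - s\<bar>"
        by (simp add: mult_right_mono)
      also have "\<dots> < e"
        using s \<open>0 \<le> M\<close> by (simp add: field_simps)
      finally show "norm (y n t - y n s) < e" .
    qed
    show "compact {a..b}"
      by simp
  qed (rule that)
  have ptw: "(\<lambda>n. y (k n) t) \<longlonglongrightarrow> x t" if "t \<in> {a..b}" for t
    unfolding LIMSEQ_iff using unif that by blast
  have h0: "(\<lambda>n. h (k n)) \<longlonglongrightarrow> 0"
    using LIMSEQ_subseq_LIMSEQ[OF LIMSEQ_inverse_real_of_nat k] by (simp add: h_def o_def)
  \<comment> \<open>The delay shifts time by at most \<open>h (k n)\<close>, also where it is
    clamped at \<open>a\<close>; the common Lipschitz constant turns this into an error of at most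
    \<open>M * h (k n)\<close>.\<close>
  have delayed: "(\<lambda>n. y (k n) (max a (s - h (k n)))) \<longlonglongrightarrow> x s" if s: "s \<in> {a..b}" for s
  proof -
    have "(\<lambda>n. y (k n) (max a (s - h (k n))) - y (k n) s) \<longlonglongrightarrow> 0"
    proof (rule Lim_null_comparison)
      show "\<forall>\<^sub>F n in sequentially.
          norm (y (k n) (max a (s - h (k n))) - y (k n) s) \<le> M * h (k n)"
      proof (rule always_eventually, rule allI)
        fix n
        have "norm (y (k n) (max a (s - h (k n))) - y (k n) s) \<le> M * \<bar>max a (s - h (k n)) - s\<bar>"
          using s h[of "k n"] by (intro lip) auto
        also have "\<dots> \<le> M * h (k n)"
          using s h[of "k n"] \<open>0 \<le> M\<close> by (intro mult_left_mono) auto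
        finally show "norm (y (k n) (max a (s - h (k n))) - y (k n) s) \<le> M * h (k n)" .
      qed
      show "(\<lambda>n. M * h (k n)) \<longlonglongrightarrow> 0"
        using tendsto_mult_right_zero[OF h0] .
    qed
    from tendsto_add[OF this ptw[OF s]] show ?thesis
      by simp
  qed
  have "isCont G v" for v
    using G by (simp add: continuous_on_eq_continuous_at)
  then have Glim: "(\<lambda>n. G (y (k n) (max a (s - h (k n))))) \<longlonglongrightarrow> G (x s)"
    if "s \<in> {a..b}" for s
    by (rule isCont_tendsto_compose[OF _ delayed[OF that]])
  have x: "x t = x\<^sub>0 + integral {a..t} (\<lambda>s. G (x s))" if t: "t \<in> {a..b}" for t
  proof -
    have "(\<lambda>n. integral {a..t} (\<lambda>s. G (y (k n) (max a (s - h (k n))))))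
        \<longlonglongrightarrow> integral {a..t} (\<lambda>s. G (x s))"
    proof (rule dominated_convergence(2)[where h="\<lambda>_. M"])
      show "(\<lambda>s. G (y (k n) (max a (s - h (k n))))) integrable_on {a..t}" for n
        using t by (intro integrable_continuous_real continuous_on_subset[OF contG]) auto
      show "(\<lambda>n. G (y (k n) (max a (s - h (k n))))) \<longlonglongrightarrow> G (x s)" if "s \<in> {a..t}" for s
        using that t by (intro Glim) auto
    qed (use M in auto)
    from tendsto_add[OF tendsto_const[of x\<^sub>0] this]
    have "(\<lambda>n. y (k n) t) \<longlonglongrightarrow> x\<^sub>0 + integral {a..t} (\<lambda>s. G (x s))"
      by (simp add: y[OF t])
    with ptw[OF t] show ?thesis
      by (rule LIMSEQ_unique)
  qed
  show thesis
  proof (rule that)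
    show "x a = x\<^sub>0"
      using x[of a] \<open>a \<le> b\<close> by simp
    have "continuous_on {a..b} (\<lambda>s. G (x s))"
      by (rule continuous_on_compose2[OF G contx]) simp
    then show "(x has_vector_derivative G (x t)) (at t within {a..b})" if "t \<in> {a..b}" for t
      using integral_equation_imp_derivative[where g="\<lambda>s. G (x s)" and x=x] x that by blast
  qed
qed

text \<open>Composing \<open>F\<close> with the projection \<open>P\<close> onto the unit ball
  around \<open>x\<^sub>0\<close> makes the field bounded, by \<open>M\<close> say. A solution of
  the modified equation cannot leave the ball before time \<open>1 / M\<close> has elapsed, and
  inside the ball \<open>P\<close> is the identity.\<close>

lemma Peano_local:
  fixes F :: "'v::euclidean_space \<Rightarrow> 'v"
  assumes F: "continuous_on UNIV F"
  obtains d x where "0 < d" "x a = x\<^sub>0"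
    "\<And>t. t \<in> {a..a + d} \<Longrightarrow> (x has_vector_derivative F (x t)) (at t within {a..a + d})"
proof -
  define P where "P = closest_point (cball x\<^sub>0 1)"
  have P: "P v \<in> cball x\<^sub>0 1" for v
    unfolding P_def by (rule closest_point_in_set) auto
  have G: "continuous_on UNIV (\<lambda>v. F (P v))"
    by (rule continuous_on_compose2[OF F])
      (auto simp: P_def intro!: continuous_on_closest_point)
  have "compact (F ` cball x\<^sub>0 1)"
    using F by (intro compact_continuous_image) (auto intro: continuous_on_subset)
  then obtain M where M: "0 < M" "\<And>v. v \<in> cball x\<^sub>0 1 \<Longrightarrow> norm (F v) \<le> M"
    by (blast dest: compact_imp_bounded bounded_pos[THEN iffD1])
  define d where "d = 1 / M"
  have "0 < d"
    using M(1) by (simp add: d_def)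
  then obtain x where xa: "x a = x\<^sub>0"
    and x: "\<And>t. t \<in> {a..a + d} \<Longrightarrow> (x has_vector_derivative F (P (x t))) (at t within {a..a + d})"
    using Peano_bounded[OF G, of M a "a + d" x\<^sub>0] M(2) P by auto
  have stay: "P (x t) = x t" if t: "t \<in> {a..a + d}" for t
  proof -
    have "norm (x a - x t) \<le> M * \<bar>a - t\<bar>"
      by (rule has_vector_derivative_imp_Lipschitz[OF _ x]) (use t M P \<open>0 < d\<close> in auto)
    also have "\<dots> \<le> M * d"
      using t M(1) by (intro mult_left_mono) auto
    also have "\<dots> = 1"
      using M(1) by (simp add: d_def)
    finally show ?thesis
      unfolding P_def by (intro closest_point_self) (simp add: xa dist_norm)
  qed
  show thesis
    using that[of d x] \<open>0 < d\<close> xa x by (simp add: stay)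
qed

section \<open>Continuation of bounded solutions\<close>

text \<open>A bounded solution has bounded speed, so it is Lipschitz and has a limit at
  \<open>b\<close>. The assumptions on \<open>J\<close> allow both \<open>{0..<b}\<close> and
  \<open>{0..b}\<close>.\<close>

lemma forward_solution_extends_to_closure:
  fixes F :: "'v::euclidean_space \<Rightarrow> 'v"
  assumes F: "continuous_on UNIV F" and sol: "forward_solution F J x"
    and J: "{0..<b} \<subseteq> J" "J \<subseteq> {0..b}" and "0 < b"
    and bound: "\<And>t. t \<in> J \<Longrightarrow> norm (x t) \<le> B"
  obtains y where "\<And>t. t \<in> J \<Longrightarrow> y t = x t"
    "\<And>t. t \<in> {0..b} \<Longrightarrow> (y has_vector_derivative F (y t)) (at t within {0..b})"
proof -
  have "convex J" and deriv: "\<And>t. t \<in> J \<Longrightarrow> (x has_vector_derivative F (x t)) (at t within J)"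
    using sol by (auto simp: forward_solution_def is_interval_convex_1)
  have "compact (F ` cball 0 B)"
    using F by (intro compact_continuous_image) (auto intro: continuous_on_subset)
  then obtain M where M: "0 < M" "\<And>v. norm v \<le> B \<Longrightarrow> norm (F v) \<le> M"
    by (force dest: compact_imp_bounded bounded_pos[THEN iffD1])
  have lip: "norm (x s - x t) \<le> M * \<bar>s - t\<bar>" if "s \<in> J" "t \<in> J" for s t
    using that M(2) bound by (intro has_vector_derivative_imp_Lipschitz[OF \<open>convex J\<close> deriv]) auto
  have "uniformly_continuous_on J x"
    unfolding uniformly_continuous_on_def
  proof (intro allI impI)
    fix e :: real assume "0 < e"
    have "dist (x t) (x s) < e" if "s \<in> J" "t \<in> J" "dist t s < e / M" for s t
      using lip[OF that(2,1)] that(3) M(1) by (simp add: dist_norm field_simps)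
    then show "\<exists>d>0. \<forall>s\<in>J. \<forall>t\<in>J. dist t s < d \<longrightarrow> dist (x t) (x s) < e"
      using \<open>0 < e\<close> M(1) by (intro exI[of _ "e / M"]) auto
  qed
  then obtain y where y: "uniformly_continuous_on (closure J) y" "\<And>t. t \<in> J \<Longrightarrow> x t = y t"
    by (rule uniformly_continuous_on_extension_on_closure) blast
  have "{0..b} \<subseteq> closure J"
    using closure_mono[OF J(1)] \<open>0 < b\<close> by simp
  then have conty: "continuous_on {0..b} y"
    using y(1) uniformly_continuous_imp_continuous continuous_on_subset by blast
  have inner: "(y has_vector_derivative F (y t)) (at t)" if t: "t \<in> {0<..<b}" for t
  proof -
    have "(x has_vector_derivative F (x t)) (at t within {0<..<b})"
      using t J by (intro has_vector_derivative_within_subset[OF deriv]) auto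
    then have "(y has_vector_derivative F (x t)) (at t within {0<..<b})"
    proof (rule has_vector_derivative_transform[OF t, rotated])
      show "y u = x u" if "u \<in> {0<..<b}" for u
        using y(2)[OF subsetD[OF J(1)], of u] that by simp
    qed
    moreover have "x t = y t"
      by (rule y(2)[OF subsetD[OF J(1)]]) (use t in simp)
    ultimately show ?thesis
      using t at_within_open[of t "{0<..<b}"] by simp
  qed
  have contF: "continuous_on {0..b} (\<lambda>t. F (y t))"
    by (rule continuous_on_compose2[OF F conty]) simp
  \<comment> \<open>The derivative is known only at interior points. The integral equation, which
    needs just continuity at the endpoints, then returns the one-sided derivatives there.\<close>
  have "y t = y 0 + integral {0..t} (\<lambda>s. F (y s))" if t: "t \<in> {0..b}" for t
  proof -
    have "((\<lambda>s. F (y s)) has_integral y t - y 0) {0..t}"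
      by (rule fundamental_theorem_of_calculus_interior)
        (use t inner in \<open>auto intro: continuous_on_subset[OF conty]\<close>)
    then show ?thesis
      by (simp add: integral_unique)
  qed
  then have "(y has_vector_derivative F (y t)) (at t within {0..b})" if "t \<in> {0..b}" for t
    using integral_equation_imp_derivative[where g="\<lambda>s. F (y s)" and x=y] contF that by blast
  with y(2) show thesis
    by (intro that[of y]) auto
qed

text \<open>If \<open>J\<close> had a finite supremum \<open>b\<close>, the solution could be closed
  up at \<open>b\<close> and continued by a local solution started from its value there, against
  maximality.\<close>

lemma maximal_bounded_solution_global:
  fixes F :: "'v::euclidean_space \<Rightarrow> 'v"
  assumes F: "continuous_on UNIV F" and max: "maximal_forward_solution F J x"
    and bound: "\<And>t. t \<in> J \<Longrightarrow> norm (x t) \<le> B"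
  shows "J = {0..}"
proof (rule ccontr)
  assume "J \<noteq> {0..}"
  have sol: "forward_solution F J x"
    using max by (simp add: maximal_forward_solution_def)
  then have int: "is_interval J" and J0: "J \<subseteq> {0..}" "0 \<in> J" "J \<noteq> {0}"
    by (auto simp: forward_solution_def)
  have mem: "t \<in> J" if "u \<in> J" "0 \<le> t" "t \<le> u" for t u
    using mem_is_interval_1_I[OF int J0(2) that] .
  have bdd: "bdd_above J"
  proof (rule ccontr)
    assume "\<not> bdd_above J"
    then have "{0..} \<subseteq> J"
      using mem by (force simp: bdd_above_def not_le dest: less_imp_le)
    with J0(1) \<open>J \<noteq> {0..}\<close> show False by auto
  qed
  define b where "b = Sup J"
  have J: "{0..<b} \<subseteq> J" "J \<subseteq> {0..b}"
  proof -
    show "{0..<b} \<subseteq> J"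
    proof
      fix t assume "t \<in> {0..<b}"
      moreover from this obtain u where "u \<in> J" "t < u"
        using less_cSup_iff[of J t] J0(2) bdd by (auto simp: b_def)
      ultimately show "t \<in> J"
        using mem[of u t] by simp
    qed
    show "J \<subseteq> {0..b}"
      using J0(1) cSup_upper[OF _ bdd] by (auto simp: b_def)
  qed
  moreover have "0 < b"
    using J0 J(2) by force
  ultimately obtain y where yx: "\<And>t. t \<in> J \<Longrightarrow> y t = x t"
    and y: "\<And>t. t \<in> {0..b} \<Longrightarrow> (y has_vector_derivative F (y t)) (at t within {0..b})"
    using forward_solution_extends_to_closure[OF F sol, of b B] bound by blast
  obtain d z where "0 < d" and zb: "z b = y b"
    and z: "\<And>t. t \<in> {b..b + d} \<Longrightarrow> (z has_vector_derivative F (z t)) (at t within {b..b + d})"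
    using Peano_local[OF F, of b "y b"] by blast
  define w where "w t = (if t \<in> {0..b} then y t else z t)" for t
  \<comment> \<open>At the junction \<open>z b = y b\<close>, so both one-sided derivatives equal
    \<open>F (y b)\<close>.\<close>
  have w: "(w has_vector_derivative F (w t)) (at t within {0..b + d})" if "t \<in> {0..b + d}" for t
  proof -
    have "((\<lambda>t. if t \<in> {0..b} then y t else z t) has_vector_derivative
        (if t \<in> {0..b} then F (y t) else F (z t))) (at t within {0..b + d})"
      by (rule has_vector_derivative_If_within_closures[where T="{b..b + d}"])
        (use that \<open>0 < b\<close> \<open>0 < d\<close> y z zb in \<open>auto simp: insert_absorb Un_absorb2\<close>)
    then show ?thesis
      by (simp add: w_def[abs_def] if_distrib[of F] cong: if_cong)
  qed
  have "continuous_on {0..b + d} (\<lambda>t. F (w t))"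
    using w has_vector_derivative_continuous continuous_on_eq_continuous_within
    by (intro continuous_on_compose2[OF F, of _ w]) blast+
  then have "forward_solution F {0..b + d} w"
    unfolding forward_solution_def using w \<open>0 < b\<close> \<open>0 < d\<close> by (auto simp: is_interval_cc)
  moreover have "J \<subseteq> {0..b + d}" "\<forall>t\<in>J. w t = x t"
    using J(2) \<open>0 < d\<close> yx by (auto simp: w_def)
  ultimately have "{0..b + d} = J"
    using max by (auto simp: maximal_forward_solution_def)
  then show False
    using J(2) \<open>0 < b\<close> \<open>0 < d\<close> by auto
qed

section \<open>The network\<close>

lemma semi_passive_sign:
  assumes "state_strictly_semi_passive f"
  obtains \<rho> where "0 < \<rho>" "\<And>x. \<rho> \<le> \<bar>x\<bar> \<Longrightarrow> x * f x < 0"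
proof -
  obtain V \<rho> H \<psi> where "0 < \<rho>" and \<psi>: "\<forall>s\<ge>0. 0 < (\<psi> s :: real)"
    and V: "\<And>x u. deriv V x * (f x + u) \<le> 2 * u * x - H x"
    and H: "\<forall>x. \<rho> \<le> \<bar>x\<bar> \<longrightarrow> \<psi> \<bar>x\<bar> \<le> H x"
    using assms unfolding state_strictly_semi_passive_def by metis
  have V': "deriv V x = 2 * x" for x
  proof (rule ccontr)
    assume neq: "deriv V x \<noteq> 2 * x"
    \<comment> \<open>The dissipation inequality reads
      \<open>(deriv V x - 2 * x) * u \<le> - H x - deriv V x * f x\<close>; this input makes the
      left side exceed the right side by exactly 1.\<close>
    define u where "u = (1 - H x - deriv V x * f x) / (deriv V x - 2 * x)"
    have "(deriv V x - 2 * x) * u = 1 - H x - deriv V x * f x"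
      using neq by (simp add: u_def)
    with V[of x u] show False
      by (simp add: algebra_simps)
  qed
  have "x * f x < 0" if "\<rho> \<le> \<bar>x\<bar>" for x
  proof -
    have "0 < \<psi> \<bar>x\<bar>" "\<psi> \<bar>x\<bar> \<le> H x"
      using \<psi> H that by auto
    then show ?thesis
      using V[of x 0] by (simp add: V')
  qed
  with \<open>0 < \<rho>\<close> show thesis
    by (rule that)
qed

lemma continuous_on_network_field:
  assumes "\<And>i. continuous_on UNIV (f i)"
  shows "continuous_on UNIV (network_field f a \<gamma>)"
proof -
  have "continuous_on UNIV (\<lambda>x :: real ^ 'a. f i (x $ i))" for i
    by (rule continuous_on_compose2[OF assms]) (auto intro: continuous_on_component)
  then show ?thesis
    unfolding network_field_def
    by (intro continuous_on_vec_lambda continuous_on_diff continuous_on_sum continuous_on_mult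
        continuous_on_const continuous_on_component continuous_on_id)
qed

text \<open>At the first time when some component hits the moving barrier \<open>p - q * t\<close> or its negative,
  the coupling points inwards, so this component would approach the barrier from outside.\<close>

lemma network_barrier:
  fixes x :: "real \<Rightarrow> real ^ 'n::finite"
  assumes a: "\<And>i j. 0 \<le> a i j" and "0 \<le> \<gamma>"
    and x: "\<And>t. t \<in> {s..e} \<Longrightarrow>
      (x has_vector_derivative network_field f a \<gamma> (x t)) (at t within {s..e})"
    and out: "\<And>i t. t \<in> {s..e} \<Longrightarrow> f i (p - q * t) < - q"
      "\<And>i t. t \<in> {s..e} \<Longrightarrow> q < f i (- (p - q * t))"
    and init: "\<And>i. \<bar>x s $ i\<bar> < p - q * s"
    and t: "t \<in> {s..e}"
  shows "\<bar>x t $ i\<bar> < p - q * t"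
proof (rule ccontr)
  assume neg: "\<not> \<bar>x t $ i\<bar> < p - q * t"
  define g where "g j u = \<bar>x u $ j\<bar> - (p - q * u)" for j u
  have contx: "continuous_on {s..e} x"
    using x has_vector_derivative_continuous continuous_on_eq_continuous_within by blast
  have contg: "continuous_on {s..e} (g j)" for j
    unfolding g_def using contx by (intro continuous_intros)
  \<comment> \<open>\<open>X\<close> collects the times at which some component is on or beyond the
    barrier. As a finite union of closed sets it contains its infimum, the first such time.\<close>
  define X where "X = (\<Union>j. {u \<in> {s..e}. 0 \<le> g j u})"
  define \<tau> where "\<tau> = Inf X"
  have "closed {u \<in> {s..e}. 0 \<le> g j u}" for j
    using continuous_closed_preimage[OF contg, of "{0..}" j] by (simp add: vimage_def Int_def)
  then have "closed X"
    unfolding X_def by (intro closed_UN) auto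
  moreover have "X \<noteq> {}"
    using neg t unfolding X_def g_def by (auto simp: not_less)
  moreover have bddX: "bdd_below X"
    unfolding X_def by (auto intro!: bdd_belowI[of _ s])
  ultimately have "\<tau> \<in> X"
    unfolding \<tau>_def by (intro closed_contains_Inf)
  then obtain i where i: "0 \<le> g i \<tau>" and \<tau>: "\<tau> \<in> {s..e}"
    by (auto simp: X_def)
  have before: "g j u < 0" if "u \<in> {s..<\<tau>}" for j u
  proof (rule ccontr)
    assume "\<not> g j u < 0"
    then have "u \<in> X"
      using that \<tau> by (auto simp: X_def not_less)
    then show False
      using cInf_lower[OF _ bddX] that by (force simp: \<tau>_def)
  qed
  have "s < \<tau>"
    using i \<tau> init[of i] by (cases "\<tau> = s") (auto simp: g_def)
  \<comment> \<open>By continuity no component is beyond the barrier at \<open>\<tau>\<close>, so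
    component \<open>i\<close> lies exactly on it.\<close>
  have at_\<tau>: "g j \<tau> \<le> 0" for j
  proof (rule continuous_le_on_closure[where f="g j" and S="{s..<\<tau>}"])
    show "continuous_on (closure {s..<\<tau>}) (g j)"
      using \<tau> \<open>s < \<tau>\<close> by (auto intro: continuous_on_subset[OF contg])
    show "\<tau> \<in> closure {s..<\<tau>}"
      using \<open>s < \<tau>\<close> by simp
    show "g j u \<le> 0" if "u \<in> {s..<\<tau>}" for u
      using before[OF that] by (rule less_imp_le)
  qed
  define \<beta> where "\<beta> = p - q * \<tau>"
  \<comment> \<open>The sign of the touching component, so that the upper and the lower barrier are
    treated at once.\<close>
  define \<sigma> where "\<sigma> = (if 0 \<le> x \<tau> $ i then 1 else - 1 :: real)"
  have \<sigma>: "\<sigma> = 1 \<or> \<sigma> = - 1"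
    by (simp add: \<sigma>_def)
  have hit: "\<sigma> * x \<tau> $ i = \<beta>"
    using i at_\<tau>[of i] by (auto simp: g_def \<sigma>_def \<beta>_def)
  then have hit': "x \<tau> $ i = \<sigma> * \<beta>"
    using \<sigma> by auto
  \<comment> \<open>Component \<open>i\<close> has the largest absolute value:
    \<open>\<sigma> * x \<tau> $ i = \<beta>\<close> dominates every
    \<open>\<sigma> * x \<tau> $ j\<close>. Hence the coupling points inwards, however large
    \<open>\<gamma>\<close> is.\<close>
  have "0 \<le> (\<Sum>j\<in>UNIV. a i j * (\<sigma> * (x \<tau> $ i - x \<tau> $ j)))"
  proof (intro sum_nonneg mult_nonneg_nonneg[OF a])
    fix j
    show "0 \<le> \<sigma> * (x \<tau> $ i - x \<tau> $ j)"
      using hit at_\<tau>[of j] \<sigma> by (auto simp: g_def \<beta>_def)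
  qed
  also have "\<dots> = \<sigma> * (\<Sum>j\<in>UNIV. a i j * (x \<tau> $ i - x \<tau> $ j))"
    by (simp add: sum_distrib_left mult_ac)
  finally have "0 \<le> \<gamma> * (\<sigma> * (\<Sum>j\<in>UNIV. a i j * (x \<tau> $ i - x \<tau> $ j)))"
    using \<open>0 \<le> \<gamma>\<close> by simp
  moreover have "\<sigma> * f i (x \<tau> $ i) + q < 0"
    using out[OF \<tau>, of i] \<sigma> unfolding hit' \<beta>_def by auto
  \<comment> \<open>This is the slope at \<open>\<tau>\<close> of the excess
    \<open>\<sigma> * x u $ i - (p - q * u)\<close>. The excess vanishes at \<open>\<tau>\<close>,
    so a negative slope makes it positive just before, contradicting the choice of
    \<open>\<tau>\<close>.\<close>
  ultimately have neg_slope: "\<sigma> * network_field f a \<gamma> (x \<tau>) $ i + q < 0"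
    by (simp add: network_field_def algebra_simps)
  have "((\<lambda>u. x u $ i) has_vector_derivative network_field f a \<gamma> (x \<tau>) $ i) (at \<tau> within {s..e})"
    by (rule bounded_linear.has_vector_derivative[OF bounded_linear_vec_nth x[OF \<tau>]])
  then have "((\<lambda>u. \<sigma> * x u $ i - (p - q * u)) has_real_derivative
      \<sigma> * network_field f a \<gamma> (x \<tau>) $ i + q) (at \<tau> within {s..e})"
    unfolding has_real_derivative_iff_has_vector_derivative[symmetric]
    by (auto intro!: derivative_eq_intros)
  from has_real_derivative_neg_dec_left[OF this neg_slope] obtain d where "0 < d"
    and d: "\<And>h. 0 < h \<Longrightarrow> \<tau> - h \<in> {s..e} \<Longrightarrow> h < d \<Longrightarrow>
      \<sigma> * x \<tau> $ i - (p - q * \<tau>) < \<sigma> * x (\<tau> - h) $ i - (p - q * (\<tau> - h))"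
    by blast
  \<comment> \<open>Halving \<open>d\<close> gives \<open>h < d\<close>, and the bound
    \<open>\<tau> - s\<close> keeps \<open>\<tau> - h\<close> in the time interval.\<close>
  define h where "h = min (d / 2) (\<tau> - s)"
  have h: "0 < h" "h < d" "\<tau> - h \<in> {s..<\<tau>}"
    using \<open>0 < d\<close> \<open>s < \<tau>\<close> by (auto simp: h_def min_def)
  have "0 < \<sigma> * x (\<tau> - h) $ i - (p - q * (\<tau> - h))"
    using d[OF h(1) _ h(2)] h(3) \<tau> hit by (auto simp: \<beta>_def)
  also have "\<dots> \<le> g i (\<tau> - h)"
    using \<sigma> by (auto simp: g_def)
  finally show False
    using before[OF h(3), of i] by simp
qed

text \<open>Provides the speed at which the barrier may shrink from \<open>R\<close> to
  \<open>\<rho>\<close>. For each node compactness gives a positive minimal inward drift, which is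
  halved to make the inequalities strict; the minimum over the finitely many nodes serves all of
  them. If \<open>R < \<rho>\<close>, the interval is empty and any positive rate will do.\<close>

lemma uniform_inward_rate:
  fixes f :: "'n::finite \<Rightarrow> real \<Rightarrow> real"
  assumes f: "\<And>i. continuous_on UNIV (f i)"
    and "0 < \<rho>" and sign: "\<And>i x. \<rho> \<le> \<bar>x\<bar> \<Longrightarrow> x * f i x < 0"
  obtains c where "0 < c" "\<And>i s. s \<in> {\<rho>..R} \<Longrightarrow> f i s < - c" "\<And>i s. s \<in> {\<rho>..R} \<Longrightarrow> c < f i (- s)"
proof -
  have "\<exists>c>0. \<forall>s\<in>{\<rho>..R}. f i s < - c \<and> c < f i (- s)" for i
  proof (cases "\<rho> \<le> R")
    case True
    define m where "m s = min (- f i s) (f i (- s))" for s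
    have "continuous_on {\<rho>..R} m"
      unfolding m_def
      by (intro continuous_intros continuous_on_compose2[OF f]) auto
    then obtain s\<^sub>0 where s\<^sub>0: "s\<^sub>0 \<in> {\<rho>..R}" "\<And>s. s \<in> {\<rho>..R} \<Longrightarrow> m s\<^sub>0 \<le> m s"
      using continuous_attains_inf[of "{\<rho>..R}" m] True by auto
    have "0 < m s\<^sub>0"
      using sign[of s\<^sub>0 i] sign[of "- s\<^sub>0" i] s\<^sub>0(1) \<open>0 < \<rho>\<close>
      by (auto simp: m_def mult_less_0_iff zero_less_mult_iff)
    moreover have "f i s < - (m s\<^sub>0 / 2) \<and> m s\<^sub>0 / 2 < f i (- s)" if "s \<in> {\<rho>..R}" for s
      using s\<^sub>0(2)[OF that] \<open>0 < m s\<^sub>0\<close> by (auto simp: m_def)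
    ultimately show ?thesis
      by (intro exI[of _ "m s\<^sub>0 / 2"]) auto
  next
    case False
    then show ?thesis
      by (intro exI[of _ 1]) auto
  qed
  then obtain c where c: "\<And>i. 0 < c i"
      "\<And>i s. s \<in> {\<rho>..R} \<Longrightarrow> f i s < - c i \<and> c i < f i (- s)"
    by metis
  have min: "Min (range c) \<le> c i" for i
    by simp
  show thesis
  proof (rule that)
    show "0 < Min (range c)"
      using c(1) by simp
    show "f i s < - Min (range c)" "Min (range c) < f i (- s)" if "s \<in> {\<rho>..R}" for i s
      using c(2)[OF that, of i] min[of i] by linarith+
  qed
qed

section \<open>Two-phase decay of the maximum norm\<close>

theorem theorem1:
  fixes f :: "'n::finite \<Rightarrow> real \<Rightarrow> real"
    and a :: "'n \<Rightarrow> 'n \<Rightarrow> real"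
  assumes "\<And>i. continuous_on UNIV (f i)"
    and "\<And>i j. 0 \<le> a i j"
    and "Digraph_Component.connected (interconnection_graph a)"
    and "has_directed_spanning_tree (interconnection_graph a)"
    and "\<And>i. state_strictly_semi_passive (f i)"
  shows "\<forall>\<gamma>\<^sub>o>0. \<exists>r>0. \<forall>r\<^sub>o>0. \<exists>T\<ge>0. \<forall>\<gamma>\<ge>\<gamma>\<^sub>o. \<forall>J (x :: real \<Rightarrow> real ^ 'n).
           maximal_forward_solution (network_field f a \<gamma>) J x \<and> norm (x 0) \<le> r\<^sub>o \<longrightarrow>
             J = {0..} \<and> (\<forall>t\<ge>T. norm (x t) \<le> r)"
proof -
  have "\<forall>i. \<exists>\<rho>>0. \<forall>x. \<rho> \<le> \<bar>x\<bar> \<longrightarrow> x * f i x < 0"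
    using semi_passive_sign[OF assms(5)] by metis
  then obtain \<rho>' where \<rho>': "\<And>i. 0 < \<rho>' i" "\<And>i x. \<rho>' i \<le> \<bar>x\<bar> \<Longrightarrow> x * f i x < 0"
    by metis
  define \<rho> where "\<rho> = Max (range \<rho>')"
  have "\<rho>' i \<le> \<rho>" for i
    by (simp add: \<rho>_def)
  with \<rho>' have "0 < \<rho>" and sign: "\<And>i x. \<rho> \<le> \<bar>x\<bar> \<Longrightarrow> x * f i x < 0"
    by (meson order_trans order.strict_trans2)+
  \<comment> \<open>Compares the maximum norm with the Euclidean norm through the sum of absolute
    values. It leads to \<open>r = CARD('n) * \<rho>\<close>, fixed before \<open>r\<^sub>o\<close>
    and \<open>\<gamma>\<close> are given.\<close>
  have norm_bound: "norm v \<le> CARD('n) * B" if "\<And>i. \<bar>v $ i\<bar> < B" for v :: "real ^ 'n" and B :: real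
    using order_trans[OF norm_le_l1_cart sum_bounded_above[of UNIV "\<lambda>i. \<bar>v $ i\<bar>" B]] that
    by (simp add: less_imp_le)
  have "\<exists>T\<ge>0. \<forall>\<gamma>\<ge>\<gamma>\<^sub>o. \<forall>J x.
      maximal_forward_solution (network_field f a \<gamma>) J x \<and> norm (x 0) \<le> r\<^sub>o \<longrightarrow>
      J = {0..} \<and> (\<forall>t\<ge>T. norm (x t) \<le> CARD('n) * \<rho>)"
    if "0 < \<gamma>\<^sub>o" "0 < r\<^sub>o" for \<gamma>\<^sub>o r\<^sub>o
  proof -
    \<comment> \<open>Since \<open>\<rho>\<close> is positive, a barrier started at \<open>R\<close>
      lies strictly outside all initial components.\<close>
    define R where "R = \<rho> + r\<^sub>o"
    obtain c where "0 < c" and c: "\<And>i s. s \<in> {\<rho>..R} \<Longrightarrow> f i s < - c"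
        "\<And>i s. s \<in> {\<rho>..R} \<Longrightarrow> c < f i (- s)"
      using uniform_inward_rate[of f \<rho> R] assms(1) \<open>0 < \<rho>\<close> sign by blast
    \<comment> \<open>The time in which a barrier of speed \<open>c\<close> moves from
      \<open>R\<close> down to \<open>\<rho>\<close>. Neither \<open>R\<close> nor \<open>c\<close>
      involves \<open>\<gamma>\<close>, hence neither does \<open>T\<close>.\<close>
    define T where "T = r\<^sub>o / c"
    have "0 < T" and cT: "c * T = r\<^sub>o"
      using \<open>0 < c\<close> \<open>0 < r\<^sub>o\<close> by (auto simp: T_def)
    have "J = {0..} \<and> (\<forall>t\<ge>T. norm (x t) \<le> CARD('n) * \<rho>)"
      if "\<gamma>\<^sub>o \<le> \<gamma>" and max: "maximal_forward_solution (network_field f a \<gamma>) J x"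
        and x0: "norm (x 0) \<le> r\<^sub>o" for \<gamma> J x
    proof -
      have "0 \<le> \<gamma>"
        using that(1) \<open>0 < \<gamma>\<^sub>o\<close> by simp
      have J: "is_interval J" "J \<subseteq> {0..}" "0 \<in> J"
        and deriv: "\<And>t. t \<in> J \<Longrightarrow>
          (x has_vector_derivative network_field f a \<gamma> (x t)) (at t within J)"
        using max by (auto simp: maximal_forward_solution_def forward_solution_def)
      have restrict: "(x has_vector_derivative network_field f a \<gamma> (x u)) (at u within {s..t})"
        if "0 \<le> s" "t \<in> J" "u \<in> {s..t}" for s t u
        using that mem_is_interval_1_I[OF J(1,3) \<open>t \<in> J\<close>]
        by (intro has_vector_derivative_within_subset[OF deriv]) auto
      \<comment> \<open>Up to time \<open>T\<close> the shrinking barrier stays in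
        \<open>{\<rho>..R}\<close>, where the drift is faster than \<open>c\<close>.\<close>
      have phase1: "\<bar>x t $ i\<bar> < R - c * t" if t: "t \<in> J" "t \<le> T" for t i
      proof (rule network_barrier[where s=0 and e=t and f=f and a=a and \<gamma>=\<gamma>])
        show "\<bar>x 0 $ j\<bar> < R - c * 0" for j
          using component_le_norm_cart[of "x 0" j] x0 \<open>0 < \<rho>\<close> by (simp add: R_def)
        have range: "R - c * u \<in> {\<rho>..R}" if "u \<in> {0..t}" for u
          using that t(2) \<open>0 < c\<close> mult_left_mono[of u T c] cT by (auto simp: R_def)
        show "f j (R - c * u) < - c" "c < f j (- (R - c * u))" if "u \<in> {0..t}" for j u
          using c range[OF that] by blast+
      qed (use assms(2) \<open>0 \<le> \<gamma>\<close> restrict t J(2) in auto)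
      \<comment> \<open>From \<open>T\<close> on the barrier rests at \<open>\<rho>\<close>, that
        is, \<open>q = 0\<close>; the strict bound at time \<open>T\<close> comes from the first
        phase, and only the signs of the drift at \<open>\<rho>\<close> and \<open>- \<rho>\<close>
        enter.\<close>
      have phase2: "\<bar>x t $ i\<bar> < \<rho>" if t: "t \<in> J" "T \<le> t" for t i
      proof -
        have "T \<in> J"
          using mem_is_interval_1_I[OF J(1,3) t(1)] t(2) \<open>0 < T\<close> by simp
        have "\<bar>x t $ i\<bar> < \<rho> - 0 * t"
        proof (rule network_barrier[where s=T and e=t and f=f and a=a and \<gamma>=\<gamma>])
          show "\<bar>x T $ j\<bar> < \<rho> - 0 * T" for j
            using phase1[OF \<open>T \<in> J\<close>, of j] cT by (simp add: R_def)
          have "f j \<rho> < 0" "0 < f j (- \<rho>)" for j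
            using sign[of \<rho> j] sign[of "- \<rho>" j] \<open>0 < \<rho>\<close>
            by (auto simp: mult_less_0_iff zero_less_mult_iff)
          then show "f j (\<rho> - 0 * u) < - 0" "0 < f j (- (\<rho> - 0 * u))" for j u
            by simp_all
        qed (use assms(2) \<open>0 \<le> \<gamma>\<close> restrict t \<open>0 < T\<close> in auto)
        then show ?thesis by simp
      qed
      \<comment> \<open>Both phases were established only for times in \<open>J\<close>; together
        they bound the solution on its whole domain, which forces \<open>J = {0..}\<close> by
        continuation.\<close>
      have "\<bar>x t $ i\<bar> < R" if "t \<in> J" for t i
      proof -
        have "0 \<le> c * t"
          using \<open>0 < c\<close> J(2) that by auto
        then show ?thesis
          using phase1[OF that, of i] phase2[OF that, of i] \<open>0 < r\<^sub>o\<close>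
          by (cases "t \<le> T") (auto simp: R_def)
      qed
      then have "J = {0..}"
        using norm_bound[of _ R]
        by (intro maximal_bounded_solution_global[OF continuous_on_network_field max] assms(1)) blast
      moreover have "norm (x t) \<le> CARD('n) * \<rho>" if "T \<le> t" for t
        using that \<open>J = {0..}\<close> \<open>0 < T\<close> by (intro norm_bound phase2) auto
      ultimately show ?thesis
        by blast
    qed
    with \<open>0 < T\<close> show ?thesis
      by (intro exI[of _ T]) auto
  qed
  moreover have "0 < CARD('n) * \<rho>"
    using \<open>0 < \<rho>\<close> by simp
  ultimately show ?thesis
    by blast
qed

end
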